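(* Consider the system $$\dot x=y,\qquad \dot y=f(\boldsymbol{\omega}t)-\gamma y-x^{2p},$$ with $p\in\mathbb{N}$ and $\gamma>0$, and let $0<f<F$ be constants such that $f^{2p}\le f(\boldsymbol{\omega}t)\le F^{2p}$ for all $t$. Let $-\xi$ be the unique root in $(-\infty,-F)$ of $$h(x)=2px^{2p-1}(F^{2p}-x^{2p})-\gamma^2(F^{2p}-f^{2p}),$$ and let $$\mathcal{J}=\{(x,y):\ x\le-\xi,\ (F^{2p}-x^{2p})/\gamma\le y\le 0\}.$$ For all $\boldsymbol{x}_0=(x_0,y_0)\in\mathcal{J}$ there exists $-X_0\le-\xi$ which is such that $\boldsymbol{x}_0\in\mathcal{S}(-X_0)$. All solutions starting from such an $\boldsymbol{x}_0$ blow up in finite time.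
   Context: The symbol $f$ without argument is a constant, distinct from the forcing $t\mapsto f(\boldsymbol{\omega}t)$, which is a real-valued analytic quasi-periodic function with frequency vector $\boldsymbol{\omega}\in\mathbb{R}^d$. For $-X_0\le-\xi$, $$\mathcal{S}(-X_0)=\{(x,y):\ x\le-\xi,\ U\ge y\ge(F^{2p}-x^{2p})/\gamma\},$$ where $U=-b(-X_0-x)^{3/2}$ for $x\le-X_0$ and $U=0$ otherwise, and $b>0$ is a constant chosen sufficiently small, so that $\mathcal{S}(-X_0)$ is a positively invariant subset of $\mathcal{J}$ containing points $(x,y)$ with $y\to-\infty$. "Blow up in finite time" means that the solution becomes unbounded within a finite positive time (it cannot be continued for all $t\ge0$). *)

theory Defs
  imports "HOL-Analysis.Analysis"
begin

text \<open>Real analyticity in several variables: near every point the function is the sum of its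
  power series over multi-indices \<open>\<alpha>\<close> (one exponent per coordinate).\<close>

definition real_analytic :: "(real ^ 'd \<Rightarrow> real) \<Rightarrow> bool" where
  "real_analytic \<Phi> \<longleftrightarrow>
    (\<forall>a. \<exists>c :: ('d \<Rightarrow> nat) \<Rightarrow> real. \<exists>r>0. \<forall>\<theta>. (\<forall>i. \<bar>\<theta> $ i - a $ i\<bar> < r) \<longrightarrow>
      ((\<lambda>\<alpha>. c \<alpha> * (\<Prod>i\<in>UNIV. (\<theta> $ i - a $ i) ^ \<alpha> i)) has_sum \<Phi> \<theta>) UNIV)"

text \<open>Functions on the torus are functions on the whole space with period \<open>2\<pi>\<close> in each
  coordinate.\<close>

definition torus_periodic :: "(real ^ 'd \<Rightarrow> real) \<Rightarrow> bool" where
  "torus_periodic \<Phi> \<longleftrightarrow> (\<forall>\<theta> i. \<Phi> (\<theta> + axis i (2 * pi)) = \<Phi> \<theta>)"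

definition vector_field ::
    "(real \<Rightarrow> real) \<Rightarrow> real \<Rightarrow> nat \<Rightarrow> real \<Rightarrow> real \<times> real \<Rightarrow> real \<times> real" where
  "vector_field g \<gamma> p t = (\<lambda>(x, y). (y, g t - \<gamma> * y - x ^ (2 * p)))"

text \<open>Derivatives are taken within the interval \<open>I\<close>, hence are one-sided at those of its
  endpoints that belong to it.\<close>

definition solves :: "(real \<Rightarrow> real \<times> real \<Rightarrow> real \<times> real) \<Rightarrow> real set \<Rightarrow>
    (real \<Rightarrow> real \<times> real) \<Rightarrow> bool" where
  "solves v I z \<longleftrightarrow> (\<forall>t\<in>I. (z has_vector_derivative v t (z t)) (at t within I))"

definition forward_interval :: "ereal \<Rightarrow> real set" where
  "forward_interval T = {t. 0 \<le> t \<and> ereal t < T}"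

text \<open>A solution issuing from time \<open>0\<close> that cannot be continued beyond \<open>T\<close>; the value
  \<open>T = \<infinity>\<close> is allowed.\<close>

definition maximal_solution :: "(real \<Rightarrow> real \<times> real \<Rightarrow> real \<times> real) \<Rightarrow> ereal \<Rightarrow>
    (real \<Rightarrow> real \<times> real) \<Rightarrow> bool" where
  "maximal_solution v T z \<longleftrightarrow> 0 < T \<and> solves v (forward_interval T) z \<and>
    \<not> (\<exists>T' z'. T < T' \<and> solves v (forward_interval T') z' \<and>
         (\<forall>t\<in>forward_interval T. z' t = z t))"

definition blows_up_in_finite_time :: "ereal \<Rightarrow> (real \<Rightarrow> real \<times> real) \<Rightarrow> bool" where
  "blows_up_in_finite_time T z \<longleftrightarrow> T < \<infinity> \<and> \<not> bounded (z ` forward_interval T)"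

text \<open>The field is non-autonomous, so invariance is required from every initial time.\<close>

definition positively_invariant ::
    "(real \<Rightarrow> real \<times> real \<Rightarrow> real \<times> real) \<Rightarrow> (real \<times> real) set \<Rightarrow> bool" where
  "positively_invariant v A \<longleftrightarrow>
    (\<forall>t0 t1 z. t0 \<le> t1 \<and> solves v {t0..t1} z \<and> z t0 \<in> A \<longrightarrow> (\<forall>t\<in>{t0..t1}. z t \<in> A))"

definition h :: "nat \<Rightarrow> real \<Rightarrow> real \<Rightarrow> real \<Rightarrow> real \<Rightarrow> real" where
  "h p \<gamma> f F x = 2 * real p * x ^ (2 * p - 1) * (F ^ (2 * p) - x ^ (2 * p))
     - \<gamma>\<^sup>2 * (F ^ (2 * p) - f ^ (2 * p))"

definition xi :: "nat \<Rightarrow> real \<Rightarrow> real \<Rightarrow> real \<Rightarrow> real" where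
  "xi p \<gamma> f F = - (THE r. r < - F \<and> h p \<gamma> f F r = 0)"

definition J :: "nat \<Rightarrow> real \<Rightarrow> real \<Rightarrow> real \<Rightarrow> (real \<times> real) set" where
  "J p \<gamma> f F =
    {(x, y). x \<le> - xi p \<gamma> f F \<and> (F ^ (2 * p) - x ^ (2 * p)) / \<gamma> \<le> y \<and> y \<le> 0}"

definition U :: "real \<Rightarrow> real \<Rightarrow> real \<Rightarrow> real" where
  "U b X0 x = (if x \<le> - X0 then - b * (- X0 - x) powr (3 / 2) else 0)"

text \<open>\<open>S p \<gamma> f F b X0\<close> is the set written \<open>S(-X0)\<close> in the usual notation.\<close>

definition S :: "nat \<Rightarrow> real \<Rightarrow> real \<Rightarrow> real \<Rightarrow> real \<Rightarrow> real \<Rightarrow> (real \<times> real) set" where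
  "S p \<gamma> f F b X0 =
    {(x, y). x \<le> - xi p \<gamma> f F \<and> U b X0 x \<ge> y \<and> y \<ge> (F ^ (2 * p) - x ^ (2 * p)) / \<gamma>}"

text \<open>The requirement that governs the choice of \<open>b\<close>, uniformly in \<open>X0\<close>.\<close>

definition admissible ::
    "(real \<Rightarrow> real) \<Rightarrow> nat \<Rightarrow> real \<Rightarrow> real \<Rightarrow> real \<Rightarrow> real \<Rightarrow> bool" where
  "admissible g p \<gamma> f F b \<longleftrightarrow> b > 0 \<and>
    (\<forall>X0. - X0 \<le> - xi p \<gamma> f F \<longrightarrow>
       positively_invariant (vector_field g \<gamma> p) (S p \<gamma> f F b X0) \<and>
       S p \<gamma> f F b X0 \<subseteq> J p \<gamma> f F \<and>
       (\<forall>M. \<exists>x y. (x, y) \<in> S p \<gamma> f F b X0 \<and> y < M))"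

end

theory Submission imports Defs begin

text \<open>The set \<open>S p \<gamma> f F b X0\<close> is a region that orbits cannot leave and on which, to the left of
  \<open>- X0\<close>, the velocity \<open>x' = y \<le> - b (- X0 - x)\<^sup>3\<^sup>/\<^sup>2\<close> is superlinear in the distance travelled.

  Three barriers make the region positively invariant. On the upper curve \<open>y = U b X0 x\<close> the field
  does not point upwards when \<open>b\<close> is small: the restoring term \<open>- x\<^sup>2\<^sup>p\<close> grows in size at least
  quadratically along the curve, while the forcing is bounded, the damping has order \<open>3/2\<close>, and the
  slope of the curve contributes a quadratic term with coefficient of order \<open>b\<^sup>2\<close>
  (\<open>curve_condition_of_small\<close>, \<open>upper_curve_drift\<close>). On the lower curve
  \<open>y = (F\<^sup>2\<^sup>p - x\<^sup>2\<^sup>p) / \<gamma>\<close> the field does not point out of the region as soon as \<open>h x \<ge> 0\<close>,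
  which is what \<open>x \<le> - \<xi>\<close> ensures (\<open>lower_curve_drift\<close>). The line \<open>x = - \<xi>\<close> is not crossed because
  \<open>y \<le> 0\<close>. The contact with these barriers can be degenerate at the corners of the region, so the
  proof uses the drift on their far side rather than a strict inequality on them (\<open>barrier_nonneg\<close>,
  \<open>bootstrap_upper_bound\<close>).

  In such a region no solution lives forever. The quantity \<open>\<gamma> x + y\<close> decreases at a uniform rate,
  because \<open>x\<^sup>2\<^sup>p \<ge> \<xi>\<^sup>2\<^sup>p\<close> exceeds every value of the forcing by a fixed amount; this pushes \<open>x\<close> below
  \<open>- X0\<close>. Afterwards \<open>\<sigma> = - X0 - x\<close> satisfies \<open>\<sigma>' \<ge> b \<sigma>\<^sup>3\<^sup>/\<^sup>2\<close>, so \<open>\<sigma>\<^sup>-\<^sup>1\<^sup>/\<^sup>2\<close> would reach zero in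
  finite time (\<open>no_global_solution_in_S\<close>). Hence the maximal existence time \<open>T\<close> is finite. A solution
  that stays bounded up to a finite \<open>T\<close> can be continued by Picard's theorem
  (\<open>bounded_solution_extends\<close>), so a maximal one is unbounded. This last step needs a continuous
  forcing, which analyticity provides.\<close>

section \<open>Continuity of real-analytic functions\<close>

text \<open>Absolute convergence of the power series at the corner \<open>a + (\<rho>, \<dots>, \<rho>)\<close> of a cube
  dominates it uniformly on the whole cube, so the sum is a uniform limit of polynomials.\<close>

lemma real_analytic_imp_continuous:
  fixes \<Phi> :: "real ^ 'd \<Rightarrow> real"
  assumes "real_analytic \<Phi>"
  shows "continuous_on UNIV \<Phi>"
proof -
  have "isCont \<Phi> a" for a
  proof -
    obtain c :: "('d \<Rightarrow> nat) \<Rightarrow> real" and r where "r > 0" and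
      series: "\<And>\<theta>. (\<forall>i. \<bar>\<theta> $ i - a $ i\<bar> < r) \<Longrightarrow>
        ((\<lambda>\<alpha>. c \<alpha> * (\<Prod>i\<in>UNIV. (\<theta> $ i - a $ i) ^ \<alpha> i)) has_sum \<Phi> \<theta>) UNIV"
      using assms unfolding real_analytic_def by blast
    define \<rho> where "\<rho> = r / 2"
    have \<rho>: "0 < \<rho>" "\<rho> < r"
      using \<open>r > 0\<close> by (auto simp: \<rho>_def)
    define Y where "Y = {\<theta> :: real ^ 'd. \<forall>i. \<bar>\<theta> $ i - a $ i\<bar> \<le> \<rho>}"
    have "(\<lambda>\<alpha>. c \<alpha> * (\<Prod>i\<in>UNIV. ((\<chi> j. a $ j + \<rho>) $ i - a $ i) ^ \<alpha> i)) summable_on UNIV"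
      using series[of "\<chi> j. a $ j + \<rho>"] \<rho> has_sum_imp_summable by fastforce
    then have "(\<lambda>\<alpha>. \<bar>c \<alpha> * (\<Prod>i\<in>(UNIV :: 'd set). \<rho> ^ \<alpha> i)\<bar>) summable_on UNIV"
      by (subst (asm) summable_on_iff_abs_summable_on_real) simp
    moreover have "norm (c \<alpha> * (\<Prod>i\<in>UNIV. (\<theta> $ i - a $ i) ^ \<alpha> i))
        \<le> \<bar>c \<alpha> * (\<Prod>i\<in>(UNIV :: 'd set). \<rho> ^ \<alpha> i)\<bar>" if "\<theta> \<in> Y" for \<alpha> \<theta>
      using that \<rho>(1) unfolding Y_def
      by (auto simp: abs_mult abs_prod power_abs intro!: mult_left_mono prod_mono power_mono)
    moreover have "((\<lambda>\<alpha>. c \<alpha> * (\<Prod>i\<in>UNIV. (\<theta> $ i - a $ i) ^ \<alpha> i)) has_sum \<Phi> \<theta>) UNIV"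
      if "\<theta> \<in> Y" for \<theta>
      using that \<rho> by (intro series) (auto simp: Y_def intro: le_less_trans)
    ultimately have "uniform_limit Y
        (\<lambda>A \<theta>. \<Sum>\<alpha>\<in>A. c \<alpha> * (\<Prod>i\<in>UNIV. (\<theta> $ i - a $ i) ^ \<alpha> i)) \<Phi>
        (finite_subsets_at_top UNIV)"
      by (intro Weierstrass_m_test_general') auto
    then have "continuous_on Y \<Phi>"
      by (rule uniform_limit_theorem[rotated])
        (auto intro!: always_eventually continuous_intros)
    moreover have "ball a \<rho> \<subseteq> Y"
    proof
      fix \<theta> assume "\<theta> \<in> ball a \<rho>"
      then have "\<bar>(\<theta> - a) $ i\<bar> \<le> \<rho>" for i
        using component_le_norm_cart[of "\<theta> - a" i] by (simp add: dist_norm norm_minus_commute)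
      then show "\<theta> \<in> Y" by (simp add: Y_def)
    qed
    ultimately have "continuous_on (ball a \<rho>) \<Phi>"
      using continuous_on_subset by blast
    then show ?thesis
      using \<rho>(1) by (simp add: continuous_on_eq_continuous_at)
  qed
  then show ?thesis by (simp add: continuous_at_imp_continuous_on)
qed

section \<open>Continuation of bounded solutions\<close>

text \<open>The Picard operator \<open>\<phi> \<mapsto> z0 + \<integral> v s (\<phi> s) ds\<close> is a contraction of a ball of bounded
  continuous functions as soon as the time interval is short.\<close>

lemma picard_local_existence:
  fixes v :: "real \<Rightarrow> 'a::euclidean_space \<Rightarrow> 'a"
  assumes "R > 0"
    and cont: "continuous_on ({t0..t0 + R} \<times> cball z0 R) (\<lambda>(t, z). v t z)"
    and lip: "\<And>t z w. t \<in> {t0..t0 + R} \<Longrightarrow> z \<in> cball z0 R \<Longrightarrow> w \<in> cball z0 R \<Longrightarrow>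
      norm (v t z - v t w) \<le> K * norm (z - w)"
  obtains \<epsilon> w where "\<epsilon> > 0" "w t0 = z0"
    "\<And>t. t \<in> {t0..t0 + \<epsilon>} \<Longrightarrow>
      (w has_vector_derivative v t (w t)) (at t within {t0..t0 + \<epsilon>})"
proof -
  have "compact ((\<lambda>(t, z). v t z) ` ({t0..t0 + R} \<times> cball z0 R))"
    by (intro compact_continuous_image cont compact_Times compact_Icc compact_cball)
  then obtain M where "M > 0" and M: "\<And>t z. t \<in> {t0..t0 + R} \<Longrightarrow> z \<in> cball z0 R \<Longrightarrow> norm (v t z) \<le> M"
    by (fastforce dest!: compact_imp_bounded simp: bounded_pos)
  \<comment> \<open>The bound \<open>R / M\<close> keeps the operator inside the ball of radius \<open>R\<close>; the last bound makes it
    a contraction with factor \<open>1/2\<close>.\<close>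
  define \<epsilon> where "\<epsilon> = min R (min (R / M) (1 / (2 * (\<bar>K\<bar> + 1))))"
  have \<epsilon>: "0 < \<epsilon>" "\<epsilon> \<le> R" "M * \<epsilon> \<le> R" "\<bar>K\<bar> * \<epsilon> \<le> 1 / 2"
  proof -
    show "0 < \<epsilon>" "\<epsilon> \<le> R"
      using \<open>R > 0\<close> \<open>M > 0\<close> by (auto simp: \<epsilon>_def)
    have "\<epsilon> \<le> R / M" by (simp add: \<epsilon>_def)
    then show "M * \<epsilon> \<le> R"
      using \<open>M > 0\<close> by (simp add: field_simps)
    have "(\<bar>K\<bar> + 1) * \<epsilon> \<le> (\<bar>K\<bar> + 1) * (1 / (2 * (\<bar>K\<bar> + 1)))"
      by (intro mult_left_mono) (auto simp: \<epsilon>_def)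
    also have "\<dots> = 1 / 2" by (simp add: field_simps)
    finally show "\<bar>K\<bar> * \<epsilon> \<le> 1 / 2"
      using \<open>0 < \<epsilon>\<close> by (simp add: algebra_simps)
  qed
  \<comment> \<open>Freezing time outside the interval turns functions on it into functions on the whole line,
    for which the space of bounded continuous functions is complete.\<close>
  define cl where "cl t = max t0 (min t (t0 + \<epsilon>))" for t
  have cl: "cl t \<in> {t0..t0 + \<epsilon>}" for t
    using \<epsilon> by (auto simp: cl_def)
  define B where "B = cball (const_bcontfun z0 :: real \<Rightarrow>\<^sub>C 'a) R"
  have B_iff: "\<phi> \<in> B \<longleftrightarrow> (\<forall>s. apply_bcontfun \<phi> s \<in> cball z0 R)" for \<phi>
  proof
    assume "\<phi> \<in> B"
    then have "dist (apply_bcontfun (const_bcontfun z0) s) (apply_bcontfun \<phi> s) \<le> R" for s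
      unfolding B_def using dist_bounded[of "const_bcontfun z0" s \<phi>] by simp
    then show "\<forall>s. apply_bcontfun \<phi> s \<in> cball z0 R"
      by (simp add: const_bcontfun.rep_eq)
  next
    show "\<forall>s. apply_bcontfun \<phi> s \<in> cball z0 R \<Longrightarrow> \<phi> \<in> B"
      unfolding B_def by (auto simp: const_bcontfun.rep_eq intro!: dist_bound)
  qed
  define G where "G \<phi> s = v s (apply_bcontfun \<phi> s)" for \<phi> s
  have G_cont: "continuous_on {t0..t0 + \<epsilon>} (G \<phi>)" if "\<phi> \<in> B" for \<phi>
  proof -
    have "continuous_on {t0..t0 + \<epsilon>} (\<lambda>s. (\<lambda>(t, z). v t z) (s, apply_bcontfun \<phi> s))"
      using that \<epsilon> unfolding B_iff
      by (intro continuous_on_compose2[OF cont] continuous_intros) auto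
    then show ?thesis by (simp add: G_def[abs_def])
  qed
  have G_int: "G \<phi> integrable_on {t0..cl t}" if "\<phi> \<in> B" for \<phi> t
    using G_cont[OF that] cl[of t]
    by (intro integrable_continuous_real) (auto elim!: continuous_on_subset)
  define I where "I \<phi> t = z0 + integral {t0..cl t} (G \<phi>)" for \<phi> t
  have I_near: "I \<phi> t \<in> cball z0 R" if "\<phi> \<in> B" for \<phi> t
  proof -
    have "norm (integral {t0..cl t} (G \<phi>)) \<le> M * (cl t - t0)"
    proof (rule integral_bound)
      show "continuous_on {t0..cl t} (G \<phi>)"
        using G_cont[OF that] cl[of t] by (auto elim!: continuous_on_subset)
      show "norm (G \<phi> s) \<le> M" if "s \<in> {t0..cl t}" for s
        unfolding G_def using that \<open>\<phi> \<in> B\<close> cl[of t] \<epsilon> by (intro M) (auto simp: B_iff)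
    qed (use cl[of t] in auto)
    also have "\<dots> \<le> M * \<epsilon>"
      using cl[of t] \<open>M > 0\<close> by (intro mult_left_mono) auto
    also have "\<dots> \<le> R" by (rule \<epsilon>)
    finally show ?thesis by (simp add: I_def dist_norm)
  qed
  have I_cont: "continuous_on UNIV (I \<phi>)" if "\<phi> \<in> B" for \<phi>
  proof -
    have "continuous_on {t0..t0 + \<epsilon>} (\<lambda>u. integral {t0..u} (G \<phi>))"
      by (intro indefinite_integral_continuous_1 integrable_continuous_real G_cont that)
    moreover have "continuous_on UNIV cl"
      unfolding cl_def by (intro continuous_intros)
    moreover have "range cl \<subseteq> {t0..t0 + \<epsilon>}"
      using cl by blast
    ultimately have "continuous_on UNIV (\<lambda>t. integral {t0..cl t} (G \<phi>))"
      by (rule continuous_on_compose2)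
    then show ?thesis
      unfolding I_def by (intro continuous_intros)
  qed
  define P where "P \<phi> = Bcontfun (I \<phi>)" for \<phi>
  have P: "apply_bcontfun (P \<phi>) = I \<phi>" if "\<phi> \<in> B" for \<phi>
  proof -
    have "range (I \<phi>) \<subseteq> cball z0 R" using I_near[OF that] by auto
    then have "bounded (range (I \<phi>))" using bounded_cball bounded_subset by blast
    then show ?thesis
      unfolding P_def using I_cont[OF that] by (intro Bcontfun_inverse) (auto simp: bcontfun_def)
  qed
  have contraction: "dist (P \<phi>) (P \<psi>) \<le> 1 / 2 * dist \<phi> \<psi>" if \<phi>: "\<phi> \<in> B" and \<psi>: "\<psi> \<in> B" for \<phi> \<psi>
  proof (rule dist_bound)
    fix t
    have "norm (integral {t0..cl t} (\<lambda>s. G \<phi> s - G \<psi> s)) \<le> (\<bar>K\<bar> * dist \<phi> \<psi>) * (cl t - t0)"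
    proof (rule integral_bound)
      show "continuous_on {t0..cl t} (\<lambda>s. G \<phi> s - G \<psi> s)"
        using G_cont[OF \<phi>] G_cont[OF \<psi>] cl[of t]
        by (intro continuous_intros) (auto elim!: continuous_on_subset)
      show "norm (G \<phi> s - G \<psi> s) \<le> \<bar>K\<bar> * dist \<phi> \<psi>" if s: "s \<in> {t0..cl t}" for s
      proof -
        have "norm (G \<phi> s - G \<psi> s) \<le> K * norm (apply_bcontfun \<phi> s - apply_bcontfun \<psi> s)"
          unfolding G_def using \<phi> \<psi> s cl[of t] \<epsilon> by (intro lip) (auto simp: B_iff)
        also have "\<dots> \<le> \<bar>K\<bar> * dist \<phi> \<psi>"
          using dist_bounded[of \<phi> s \<psi>] by (intro mult_mono) (auto simp: dist_norm)
        finally show "norm (G \<phi> s - G \<psi> s) \<le> \<bar>K\<bar> * dist \<phi> \<psi>" .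
      qed
    qed (use cl[of t] in auto)
    also have "\<dots> \<le> (\<bar>K\<bar> * dist \<phi> \<psi>) * \<epsilon>"
      using cl[of t] by (intro mult_left_mono) auto
    also have "\<dots> = (\<bar>K\<bar> * \<epsilon>) * dist \<phi> \<psi>" by simp
    also have "\<dots> \<le> 1 / 2 * dist \<phi> \<psi>"
      using \<epsilon> by (intro mult_right_mono) auto
    finally show "dist (apply_bcontfun (P \<phi>) t) (apply_bcontfun (P \<psi>) t) \<le> 1 / 2 * dist \<phi> \<psi>"
      using G_int[OF \<phi>, of t] G_int[OF \<psi>, of t]
      by (simp add: P \<phi> \<psi> I_def dist_norm integral_diff)
  qed
  have "\<exists>!\<phi>\<in>B. P \<phi> = \<phi>"
  proof (rule Banach_fix[where c = "1 / 2"])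
    show "complete B" by (auto simp: B_def complete_eq_closed)
    show "B \<noteq> {}" using \<open>R > 0\<close> by (simp add: B_def)
    show "P ` B \<subseteq> B" using I_near P by (auto simp: B_iff)
  qed (use contraction in auto)
  then obtain \<phi> where "\<phi> \<in> B" "P \<phi> = \<phi>" by blast
  define w where "w = apply_bcontfun \<phi>"
  have w: "w t = z0 + integral {t0..t} (G \<phi>)" if "t \<in> {t0..t0 + \<epsilon>}" for t
  proof -
    have "w t = I \<phi> t" using P[OF \<open>\<phi> \<in> B\<close>] \<open>P \<phi> = \<phi>\<close> by (simp add: w_def)
    moreover have "cl t = t" using that by (auto simp: cl_def)
    ultimately show ?thesis by (simp add: I_def)
  qed
  have "(w has_vector_derivative v t (w t)) (at t within {t0..t0 + \<epsilon>})" if t: "t \<in> {t0..t0 + \<epsilon>}" for t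
  proof -
    have "((\<lambda>u. z0 + integral {t0..u} (G \<phi>)) has_vector_derivative 0 + G \<phi> t) (at t within {t0..t0 + \<epsilon>})"
      using t by (intro derivative_intros integral_has_vector_derivative G_cont \<open>\<phi> \<in> B\<close>)
    then have "(w has_vector_derivative 0 + G \<phi> t) (at t within {t0..t0 + \<epsilon>})"
      by (rule has_vector_derivative_transform[OF t, rotated]) (simp add: w)
    then show ?thesis by (simp add: G_def w_def)
  qed
  moreover have "w t0 = z0" using w[of t0] \<epsilon> by simp
  ultimately show thesis using that \<epsilon>(1) by blast
qed

text \<open>Where two solutions are glued, only continuity is evident. The integral form of the equation
  does not see finitely many times, and differentiating it recovers the equation at all of them.\<close>

lemma solution_up_to_finite_set:
  fixes Z :: "real \<Rightarrow> 'a::euclidean_space"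
  assumes "continuous_on {a..b} Z" "finite D"
    and v: "continuous_on UNIV (\<lambda>(t, z). v t z)"
    and deriv: "\<And>t. t \<in> {a<..<b} - D \<Longrightarrow> (Z has_vector_derivative v t (Z t)) (at t)"
    and t: "t \<in> {a..b}"
  shows "(Z has_vector_derivative v t (Z t)) (at t within {a..b})"
proof -
  define G where "G s = v s (Z s)" for s
  have "continuous_on {a..b} (\<lambda>s. (\<lambda>(t, z). v t z) (s, Z s))"
    by (intro continuous_on_compose2[OF v] continuous_intros assms) auto
  then have G: "continuous_on {a..b} G" by (simp add: G_def[abs_def])
  have Z: "Z u = Z a + integral {a..u} G" if "u \<in> {a..b}" for u
  proof -
    have "(G has_integral Z u - Z a) {a..u}"
    proof (rule fundamental_theorem_of_calculus_interior_strong[OF \<open>finite D\<close>])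
      show "(Z has_vector_derivative G x) (at x)" if "x \<in> {a<..<u} - D" for x
        unfolding G_def using that \<open>u \<in> {a..b}\<close> by (intro deriv) auto
      show "continuous_on {a..u} Z"
        using that by (auto intro: continuous_on_subset[OF assms(1)])
    qed (use that in auto)
    then show ?thesis by (simp add: integral_unique)
  qed
  have "((\<lambda>u. Z a + integral {a..u} G) has_vector_derivative 0 + G t) (at t within {a..b})"
    using t by (intro derivative_intros integral_has_vector_derivative G)
  then have "(Z has_vector_derivative 0 + G t) (at t within {a..b})"
    by (rule has_vector_derivative_transform[OF t, rotated]) (rule Z)
  then show ?thesis by (simp add: G_def)
qed

text \<open>A bounded solution has bounded speed, so it is uniformly continuous and has a limit at \<open>T\<close>; a
  local solution issuing from this limit continues it.\<close>

lemma bounded_solution_extends: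
  fixes v :: "real \<Rightarrow> 'a::euclidean_space \<Rightarrow> 'a"
  assumes "a < T"
    and v: "continuous_on UNIV (\<lambda>(t, z). v t z)"
    and lip: "\<And>R. \<exists>K. \<forall>t. \<forall>z\<in>cball 0 R. \<forall>w\<in>cball 0 R. norm (v t z - v t w) \<le> K * norm (z - w)"
    and sol: "\<And>t. t \<in> {a..<T} \<Longrightarrow> (z has_vector_derivative v t (z t)) (at t within {a..<T})"
    and bdd: "bounded (z ` {a..<T})"
  obtains T' z' where "T < T'" "\<And>t. t \<in> {a..<T} \<Longrightarrow> z' t = z t"
    "\<And>t. t \<in> {a..T'} \<Longrightarrow> (z' has_vector_derivative v t (z' t)) (at t within {a..T'})"
proof -
  have [simp]: "closure {a..<T} = {a..T}" using \<open>a < T\<close> by simp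
  obtain R where R: "\<And>t. t \<in> {a..<T} \<Longrightarrow> norm (z t) \<le> R"
    using bdd unfolding bounded_iff by (metis imageI)
  have "compact ((\<lambda>(t, z). v t z) ` ({a..T} \<times> cball 0 R))"
    by (intro compact_continuous_image continuous_on_subset[OF v] compact_Times
        compact_Icc compact_cball) auto
  then obtain M where M: "\<And>t z. t \<in> {a..T} \<Longrightarrow> z \<in> cball 0 R \<Longrightarrow> norm (v t z) \<le> M"
    by (fastforce dest!: compact_imp_bounded simp: bounded_iff)
  have "norm (v a (z a)) \<le> M" using M[of a "z a"] R[of a] \<open>a < T\<close> by auto
  then have "M \<ge> 0" using norm_ge_zero order_trans by blast
  have "norm (z s - z t) \<le> M * norm (s - t)" if "s \<in> {a..<T}" "t \<in> {a..<T}" for s t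
  proof (rule differentiable_bound[where S = "{a..<T}"])
    show "(z has_derivative (\<lambda>h. h *\<^sub>R v u (z u))) (at u within {a..<T})" if "u \<in> {a..<T}" for u
      using sol[OF that] by (simp add: has_vector_derivative_def)
    show "onorm (\<lambda>h. h *\<^sub>R v u (z u)) \<le> M" if "u \<in> {a..<T}" for u
    proof (rule onorm_le)
      fix h :: real
      show "norm (h *\<^sub>R v u (z u)) \<le> M * norm h"
        using mult_left_mono[OF M[of u "z u"], of "\<bar>h\<bar>"] R[OF that] that by (simp add: mult.commute)
    qed
  qed (use that in auto)
  then have "M-lipschitz_on {a..<T} z"
    using \<open>M \<ge> 0\<close> by (auto simp: lipschitz_on_def dist_norm)
  then have "uniformly_continuous_on {a..<T} z"
    by (rule lipschitz_on_uniformly_continuous)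
  then obtain zbar where "uniformly_continuous_on {a..T} zbar"
    and zbar: "\<And>t. t \<in> {a..<T} \<Longrightarrow> z t = zbar t"
    by (rule uniformly_continuous_on_extension_on_closure) simp
  then have zbar_cont: "continuous_on {a..T} zbar"
    by (simp add: uniformly_continuous_imp_continuous)
  obtain K where K: "\<And>t z w. z \<in> cball 0 (norm (zbar T) + 1) \<Longrightarrow> w \<in> cball 0 (norm (zbar T) + 1) \<Longrightarrow>
      norm (v t z - v t w) \<le> K * norm (z - w)"
    using lip[of "norm (zbar T) + 1"] by blast
  have near: "y \<in> cball 0 (norm (zbar T) + 1)" if "y \<in> cball (zbar T) 1" for y
    using that norm_triangle_ineq4[of "zbar T" "zbar T - y"] by (simp add: dist_norm)
  obtain \<epsilon> w where "\<epsilon> > 0" "w T = zbar T" and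
    w: "\<And>t. t \<in> {T..T + \<epsilon>} \<Longrightarrow> (w has_vector_derivative v t (w t)) (at t within {T..T + \<epsilon>})"
  proof (rule picard_local_existence[of 1 T "zbar T" v K])
    show "continuous_on ({T..T + 1} \<times> cball (zbar T) 1) (\<lambda>(t, z). v t z)"
      by (rule continuous_on_subset[OF v]) simp
    show "norm (v t z - v t w) \<le> K * norm (z - w)"
      if "z \<in> cball (zbar T) 1" "w \<in> cball (zbar T) 1" for t z w
      using that near by (intro K) auto
  qed auto
  define Z where "Z t = (if t \<le> T then zbar t else w t)" for t
  have Z_cont: "continuous_on {a..T + \<epsilon>} Z"
  proof -
    have "continuous_on ({a..T} \<union> {T..T + \<epsilon>}) (\<lambda>t. if t \<le> T then zbar t else w t)"
    proof (rule continuous_on_If)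
      show "continuous_on {T..T + \<epsilon>} w"
        by (rule continuous_on_vector_derivative) (rule w)
    qed (use zbar_cont \<open>w T = zbar T\<close> \<open>\<epsilon> > 0\<close> in auto)
    moreover have "{a..T} \<union> {T..T + \<epsilon>} = {a..T + \<epsilon>}"
      using \<open>a < T\<close> \<open>\<epsilon> > 0\<close> by auto
    ultimately show ?thesis by (simp add: Z_def[abs_def])
  qed
  have "(Z has_vector_derivative v t (Z t)) (at t)" if "t \<in> {a<..<T + \<epsilon>} - {T}" for t
  proof (cases "t < T")
    case True
    have "(z has_vector_derivative v t (z t)) (at t within {a<..<T})"
      using True that by (intro has_vector_derivative_within_subset[OF sol]) auto
    then have "(z has_vector_derivative v t (z t)) (at t)"
      using True that by (simp add: at_within_open[of t "{a<..<T}"])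
    then have "(Z has_vector_derivative v t (z t)) (at t)"
      using True that
      by (elim has_vector_derivative_transform_within_open[where S = "{a<..<T}"])
        (auto simp: Z_def zbar)
    then show ?thesis using True that by (simp add: Z_def zbar)
  next
    case False
    have "(w has_vector_derivative v t (w t)) (at t within {T<..<T + \<epsilon>})"
      using False that by (intro has_vector_derivative_within_subset[OF w]) auto
    then have "(w has_vector_derivative v t (w t)) (at t)"
      using False that by (simp add: at_within_open[of t "{T<..<T + \<epsilon>}"])
    then have "(Z has_vector_derivative v t (w t)) (at t)"
      using False that
      by (elim has_vector_derivative_transform_within_open[where S = "{T<..<T + \<epsilon>}"])
        (auto simp: Z_def)
    then show ?thesis using False that by (simp add: Z_def)
  qed
  then have "(Z has_vector_derivative v t (Z t)) (at t within {a..T + \<epsilon>})"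
    if "t \<in> {a..T + \<epsilon>}" for t
    using that by (intro solution_up_to_finite_set[OF Z_cont _ v, of "{T}"]) auto
  moreover have "Z t = z t" if "t \<in> {a..<T}" for t
    using that zbar by (simp add: Z_def)
  ultimately show thesis
    using that[of "T + \<epsilon>" Z] \<open>\<epsilon> > 0\<close> by auto
qed

section \<open>Barriers for functions of one variable\<close>

text \<open>A function that does not decrease while it is negative cannot become negative: look at the last
  time before \<open>t\<close> at which it is nonnegative. Since the hypothesis concerns only the outside of the
  barrier, degenerate contact with the barrier itself, where the derivative may vanish, is harmless.\<close>

lemma barrier_nonneg:
  fixes \<psi> \<psi>' :: "real \<Rightarrow> real"
  assumes cont: "continuous_on {a..b} \<psi>" and "\<psi> a \<ge> 0"
    and deriv: "\<And>t. a < t \<Longrightarrow> t < b \<Longrightarrow> (\<psi> has_real_derivative \<psi>' t) (at t)"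
    and below: "\<And>t. a < t \<Longrightarrow> t < b \<Longrightarrow> \<psi> t < 0 \<Longrightarrow> \<psi>' t \<ge> 0"
    and t: "t \<in> {a..b}"
  shows "\<psi> t \<ge> 0"
proof (rule ccontr)
  assume neg: "\<not> \<psi> t \<ge> 0"
  define A where "A = {a..t} \<inter> \<psi> -` {0..}"
  have cont_t: "continuous_on {a..t} \<psi>"
    using t by (auto intro: continuous_on_subset[OF cont])
  then have "closed A"
    unfolding A_def by (rule continuous_closed_preimage) auto
  then have "compact A"
    unfolding compact_eq_bounded_closed
    by (auto simp: A_def intro: bounded_subset[OF bounded_closed_interval])
  moreover have "a \<in> A" using t \<open>\<psi> a \<ge> 0\<close> by (simp add: A_def)
  ultimately obtain s where s: "s \<in> A" "\<And>u. u \<in> A \<Longrightarrow> u \<le> s"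
    using compact_attains_sup[of A] by auto
  then have "s < t" using neg by (cases "s = t") (auto simp: A_def)
  have "\<psi> s \<le> \<psi> t"
  proof (rule DERIV_nonneg_imp_increasing_open[of s t \<psi>])
    fix u assume u: "s < u" "u < t"
    then have "u \<notin> A" using s(2) by force
    then have "\<psi> u < 0" using u s(1) by (auto simp: A_def)
    then show "\<exists>d. (\<psi> has_real_derivative d) (at u) \<and> 0 \<le> d"
      using deriv[of u] below[of u] u s(1) t by (auto simp: A_def)
  qed (use \<open>s < t\<close> s(1) in \<open>auto simp: A_def intro: continuous_on_subset[OF cont_t]\<close>)
  then show False using s(1) neg by (simp add: A_def)
qed

text \<open>If the weak bound \<open>d\<close> up to a time implies the strict improvement \<open>c\<close> at that time, then \<open>d\<close> is
  never reached: at the first time of contact, the improved bound would hold as well.\<close>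

lemma bootstrap_upper_bound:
  fixes x :: "real \<Rightarrow> real"
  assumes cont: "continuous_on {a..b} x" and "x a \<le> c" and "c < d"
    and step: "\<And>t. t \<in> {a..b} \<Longrightarrow> (\<And>s. s \<in> {a..t} \<Longrightarrow> x s \<le> d) \<Longrightarrow> x t \<le> c"
    and t: "t \<in> {a..b}"
  shows "x t \<le> c"
proof (rule step[OF t], rule ccontr)
  fix s assume s: "s \<in> {a..t}" and "\<not> x s \<le> d"
  define A where "A = {a..s} \<inter> x -` {d..}"
  have cont_s: "continuous_on {a..s} x"
    using t s by (auto intro: continuous_on_subset[OF cont])
  then have "closed A"
    unfolding A_def by (rule continuous_closed_preimage) auto
  then have "compact A"
    unfolding compact_eq_bounded_closed
    by (auto simp: A_def intro: bounded_subset[OF bounded_closed_interval])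
  moreover have "s \<in> A" using s \<open>\<not> x s \<le> d\<close> by (simp add: A_def)
  ultimately obtain r where r: "r \<in> A" "\<And>u. u \<in> A \<Longrightarrow> r \<le> u"
    using compact_attains_inf[of A] by auto
  have "\<exists>u\<ge>a. u \<le> r \<and> x u = d"
    using r(1) \<open>x a \<le> c\<close> \<open>c < d\<close>
    by (intro IVT') (auto simp: A_def intro: continuous_on_subset[OF cont_s])
  then obtain u where "a \<le> u" "u \<le> r" "x u = d" by blast
  then have "u \<in> A" using r(1) by (auto simp: A_def)
  then have "x r = d" using r(2) \<open>u \<le> r\<close> \<open>x u = d\<close> by force
  moreover have "x u \<le> d" if "u \<in> {a..r}" for u
    using r(2)[of u] \<open>x r = d\<close> that r(1) by (fastforce simp: A_def)
  then have "x r \<le> c"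
    using r(1) s t by (intro step) (auto simp: A_def)
  ultimately show False using \<open>c < d\<close> by simp
qed

section \<open>The curve bounding the escape region from above\<close>

lemma has_real_derivative_pos_part_powr:
  "((\<lambda>s. max 0 s powr (3/2)) has_real_derivative 3/2 * sqrt (max 0 s)) (at s)"
proof (rule linorder_cases[of s 0])
  assume "s < 0"
  have "((\<lambda>_. 0) has_real_derivative 0) (at s)" by simp
  then have "((\<lambda>s. max 0 s powr (3/2)) has_real_derivative 0) (at s)"
    by (rule has_field_derivative_transform_within_open[where S = "{..<0}"]) (use \<open>s < 0\<close> in auto)
  then show ?thesis using \<open>s < 0\<close> by simp
next
  assume "s = 0"
  \<comment> \<open>This factorisation exhibits the slope function of Caratheodory's criterion at the kink.\<close>
  have eq: "max 0 z powr (3/2) = sqrt (max 0 z) * z" for z :: real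
    by (cases "z > 0") (auto simp: max_def powr_half_sqrt[symmetric] powr_mult_base mult.commute)
  have "isCont (\<lambda>z. sqrt (max 0 z)) (0 :: real)"
    by (intro continuous_intros)
  then show ?thesis
    unfolding CARAT_DERIV \<open>s = 0\<close> eq by (intro exI[of _ "\<lambda>z. sqrt (max 0 z)"]) auto
next
  assume "0 < s"
  have "((\<lambda>s. s powr (3/2)) has_real_derivative 3/2 * s powr (3/2 - 1)) (at s)"
    using \<open>0 < s\<close> by (rule has_real_derivative_powr)
  then have "((\<lambda>s. max 0 s powr (3/2)) has_real_derivative 3/2 * s powr (3/2 - 1)) (at s)"
    by (rule has_field_derivative_transform_within_open[where S = "{0<..}"]) (use \<open>0 < s\<close> in auto)
  then show ?thesis using \<open>0 < s\<close> by (simp add: powr_half_sqrt)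
qed

lemma U_eq: "U b X0 x = - b * max 0 (- X0 - x) powr (3/2)"
  by (auto simp: U_def max_def)

lemma U_has_real_derivative:
  "(U b X0 has_real_derivative 3/2 * b * sqrt (max 0 (- X0 - x))) (at x)"
proof -
  have "((\<lambda>x. max 0 (- X0 - x) powr (3/2)) has_real_derivative
      3/2 * sqrt (max 0 (- X0 - x)) * (-1)) (at x)"
    by (rule DERIV_chain2[OF has_real_derivative_pos_part_powr]) (auto intro!: derivative_eq_intros)
  then have "((\<lambda>x. - b * max 0 (- X0 - x) powr (3/2)) has_real_derivative
      - b * (3/2 * sqrt (max 0 (- X0 - x)) * (-1))) (at x)"
    by (rule DERIV_cmult)
  then show ?thesis by (simp add: U_eq[abs_def] algebra_simps)
qed

lemma U_nonpos: "b \<ge> 0 \<Longrightarrow> U b X0 x \<le> 0"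
  by (simp add: U_def)

section \<open>The vector field\<close>

lemma vector_field_components:
  assumes "(z has_vector_derivative vector_field g \<gamma> p t (z t)) (at t within I)"
  shows "((\<lambda>s. fst (z s)) has_real_derivative snd (z t)) (at t within I)"
    and "((\<lambda>s. snd (z s)) has_real_derivative
      g t - \<gamma> * snd (z t) - fst (z t) ^ (2 * p)) (at t within I)"
  using bounded_linear.has_vector_derivative[OF bounded_linear_fst assms]
    bounded_linear.has_vector_derivative[OF bounded_linear_snd assms]
  by (simp_all add: vector_field_def case_prod_beta has_real_derivative_iff_has_vector_derivative)

lemma vector_field_lipschitz_on_ball:
  "\<exists>K. \<forall>t. \<forall>z\<in>cball 0 R. \<forall>w\<in>cball 0 R.
    norm (vector_field g \<gamma> p t z - vector_field g \<gamma> p t w) \<le> K * norm (z - w)"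
proof (intro exI allI ballI)
  fix t and z w :: "real \<times> real" assume zw: "z \<in> cball 0 R" "w \<in> cball 0 R"
  define C where "C = real (2 * p) * R ^ (2 * p - 1)"
  have "norm (fst z) \<le> R" "norm (fst w) \<le> R"
    using zw norm_fst_le[of "fst z" "snd z"] norm_fst_le[of "fst w" "snd w"] by auto
  then have *: "fst z \<in> cball 0 R" "fst w \<in> cball 0 R" by auto
  have "norm (fst z ^ (2 * p) - fst w ^ (2 * p)) \<le> C * norm (fst z - fst w)"
  proof (rule field_differentiable_bound[OF convex_cball _ _ *])
    show "((\<lambda>x. x ^ (2 * p)) has_real_derivative real (2 * p) * x ^ (2 * p - 1))
        (at x within cball 0 R)" for x :: real
      by (auto intro!: derivative_eq_intros)
    show "norm (real (2 * p) * x ^ (2 * p - 1)) \<le> C" if "x \<in> cball 0 R" for x :: real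
      using that unfolding C_def
      by (auto simp: abs_mult power_abs intro!: mult_left_mono power_mono)
  qed
  then have power: "\<bar>fst z ^ (2 * p) - fst w ^ (2 * p)\<bar> \<le> C * \<bar>fst z - fst w\<bar>" by simp
  have "R \<ge> 0" using \<open>norm (fst z) \<le> R\<close> by (rule order_trans[OF norm_ge_zero])
  then have "C \<ge> 0" by (simp add: C_def)
  have x: "\<bar>fst z - fst w\<bar> \<le> norm (z - w)"
    using dist_fst_le[of z w] by (simp add: dist_norm)
  have y: "\<bar>snd z - snd w\<bar> \<le> norm (z - w)"
    using dist_snd_le[of z w] by (simp add: dist_norm)
  have "vector_field g \<gamma> p t z - vector_field g \<gamma> p t w =
      (snd z - snd w, - (\<gamma> * (snd z - snd w)) - (fst z ^ (2 * p) - fst w ^ (2 * p)))"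
    by (simp add: vector_field_def case_prod_beta algebra_simps)
  then have "norm (vector_field g \<gamma> p t z - vector_field g \<gamma> p t w) \<le>
      \<bar>snd z - snd w\<bar> + \<bar>- (\<gamma> * (snd z - snd w)) - (fst z ^ (2 * p) - fst w ^ (2 * p))\<bar>"
    using norm_Pair_le by (metis real_norm_def)
  also have "\<dots> \<le> \<bar>snd z - snd w\<bar> + (\<bar>\<gamma>\<bar> * \<bar>snd z - snd w\<bar> + C * \<bar>fst z - fst w\<bar>)"
    using power abs_mult[of \<gamma> "snd z - snd w"] by linarith
  also have "\<dots> \<le> norm (z - w) + (\<bar>\<gamma>\<bar> * norm (z - w) + C * norm (z - w))"
    using x y \<open>C \<ge> 0\<close> by (intro add_mono mult_left_mono) auto
  also have "\<dots> = (1 + \<bar>\<gamma>\<bar> + real (2 * p) * R ^ (2 * p - 1)) * norm (z - w)"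
    by (simp add: C_def algebra_simps)
  finally show "norm (vector_field g \<gamma> p t z - vector_field g \<gamma> p t w) \<le>
      (1 + \<bar>\<gamma>\<bar> + real (2 * p) * R ^ (2 * p - 1)) * norm (z - w)" .
qed

lemma maximal_solution_unbounded:
  assumes "continuous_on UNIV g" and max: "maximal_solution (vector_field g \<gamma> p) (ereal T) z"
  shows "\<not> bounded (z ` forward_interval (ereal T))"
proof
  have I: "forward_interval (ereal r) = {0..<r}" for r
    by (auto simp: forward_interval_def)
  assume bdd: "bounded (z ` forward_interval (ereal T))"
  have v: "continuous_on UNIV (\<lambda>(t, z). vector_field g \<gamma> p t z)"
    unfolding vector_field_def case_prod_beta
    by (intro continuous_intros continuous_on_compose2[OF assms(1)]) auto
  obtain T' z' where "T < T'" and ext: "\<And>t. t \<in> {0..<T} \<Longrightarrow> z' t = z t"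
    and sol: "\<And>t. t \<in> {0..T'} \<Longrightarrow>
      (z' has_vector_derivative vector_field g \<gamma> p t (z' t)) (at t within {0..T'})"
    by (rule bounded_solution_extends[OF _ v vector_field_lipschitz_on_ball, of 0 T z])
      (use max bdd in \<open>auto simp: maximal_solution_def solves_def I\<close>)
  have "solves (vector_field g \<gamma> p) (forward_interval (ereal T')) z'"
    unfolding solves_def I by (auto intro: has_vector_derivative_within_subset[OF sol])
  moreover have "ereal T < ereal T'" using \<open>T < T'\<close> by simp
  moreover have "\<forall>t\<in>forward_interval (ereal T). z' t = z t" using ext by (simp add: I)
  ultimately show False
    using max unfolding maximal_solution_def by blast
qed

section \<open>The root of \<open>h\<close>\<close>

text \<open>In the variable \<open>u = - x\<close> the nonconstant part of \<open>h\<close> is a product of increasing factors that are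
  nonnegative for \<open>u \<ge> F\<close>.\<close>

lemma h_minus:
  assumes "p \<ge> 1"
  shows "h p \<gamma> f F (- u) =
    2 * real p * u ^ (2 * p - 1) * (u ^ (2 * p) - F ^ (2 * p)) - \<gamma>\<^sup>2 * (F ^ (2 * p) - f ^ (2 * p))"
proof -
  have "odd (2 * p - 1)" using assms by simp
  then show ?thesis by (simp add: h_def algebra_simps)
qed

lemma h_strict_antimono:
  assumes "p \<ge> 1" "0 < F" "x < y" "y \<le> - F"
  shows "h p \<gamma> f F y < h p \<gamma> f F x"
proof -
  have "(- y) ^ (2 * p - 1) * ((- y) ^ (2 * p) - F ^ (2 * p))
      < (- x) ^ (2 * p - 1) * ((- x) ^ (2 * p) - F ^ (2 * p))"
  proof (rule mult_le_less_imp_less)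
    show "(- y) ^ (2 * p - 1) \<le> (- x) ^ (2 * p - 1)"
      using assms by (intro power_mono) auto
    show "(- y) ^ (2 * p) - F ^ (2 * p) < (- x) ^ (2 * p) - F ^ (2 * p)"
      using assms by (intro diff_strict_right_mono power_strict_mono) auto
    show "0 < (- y) ^ (2 * p - 1)" using assms by (intro zero_less_power) auto
    have "F ^ (2 * p) \<le> (- y) ^ (2 * p)" using assms by (intro power_mono) auto
    then show "0 \<le> (- y) ^ (2 * p) - F ^ (2 * p)" by simp
  qed
  then show ?thesis
    using h_minus[OF assms(1), of \<gamma> f F "- x"] h_minus[OF assms(1), of \<gamma> f F "- y"] assms(1)
    by (simp add: mult.assoc)
qed

lemma h_unique_root:
  assumes "p \<ge> 1" "\<gamma> > 0" "0 < f" "f < F"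
  shows "\<exists>!r. r < - F \<and> h p \<gamma> f F r = 0"
proof -
  define c where "c = \<gamma>\<^sup>2 * (F ^ (2 * p) - f ^ (2 * p))"
  have "c > 0"
    using assms by (auto simp: c_def intro!: mult_pos_pos power_strict_mono)
  \<comment> \<open>At \<open>- u\<close> the product is at least \<open>u - F = 1 + c\<close>, which exceeds the constant \<open>c\<close>.\<close>
  define u where "u = F + 1 + c"
  have u: "u \<ge> 1" "u > F" using assms \<open>c > 0\<close> by (auto simp: u_def)
  have split: "v ^ (2 * p) = v * v ^ (2 * p - 1)" for v :: real
    using assms(1) by (simp flip: power_Suc)
  have "F ^ (2 * p) \<le> F * u ^ (2 * p - 1)"
    unfolding split[of F] using assms u by (intro mult_left_mono power_mono) auto
  then have "(u - F) * u ^ (2 * p - 1) \<le> u ^ (2 * p) - F ^ (2 * p)"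
    by (simp add: split[of u] left_diff_distrib)
  moreover have pow: "1 \<le> u ^ (2 * p - 1)" using u by simp
  then have "u - F \<le> (u - F) * u ^ (2 * p - 1)"
    using u mult_left_mono[OF pow, of "u - F"] by simp
  ultimately have "1 + c \<le> u ^ (2 * p) - F ^ (2 * p)" by (simp add: u_def)
  moreover have "1 \<le> 2 * real p * u ^ (2 * p - 1)"
    using mult_mono[of 1 "2 * real p" 1 "u ^ (2 * p - 1)"] assms(1) pow by simp
  ultimately have "1 * (1 + c) \<le> 2 * real p * u ^ (2 * p - 1) * (u ^ (2 * p) - F ^ (2 * p))"
    using \<open>c > 0\<close> by (intro mult_mono) auto
  then have "0 < h p \<gamma> f F (- u)"
    using assms(1) by (simp add: h_minus c_def)
  moreover have at_F: "h p \<gamma> f F (- F) < 0"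
    using assms(1) \<open>c > 0\<close> by (simp add: h_minus c_def)
  ultimately have "\<exists>r\<ge>- u. r \<le> - F \<and> h p \<gamma> f F r = 0"
    using u unfolding h_def by (intro IVT2') (auto intro!: continuous_intros)
  then obtain r where "r \<le> - F" "h p \<gamma> f F r = 0" by blast
  moreover have "r \<noteq> - F" using at_F calculation by auto
  moreover have "s = r" if "s < - F" "h p \<gamma> f F s = 0" for s
    using h_strict_antimono[of p F s r \<gamma> f] h_strict_antimono[of p F r s \<gamma> f]
      that calculation assms by (cases s r rule: linorder_cases) auto
  ultimately show ?thesis by (intro ex1I[of _ r]) auto
qed

section \<open>Finite-time escape on the line\<close>

text \<open>The exponent \<open>3/2 > 1\<close> makes \<open>\<sigma>\<^sup>-\<^sup>1\<^sup>/\<^sup>2\<close> decrease at rate at least \<open>b/2\<close>, so this positive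
  quantity would reach zero.\<close>

lemma no_global_growth_three_halves:
  fixes \<sigma> \<sigma>' :: "real \<Rightarrow> real"
  assumes b: "b > 0" and cont: "continuous_on {t1..} \<sigma>"
    and pos: "\<And>t. t \<ge> t1 \<Longrightarrow> \<sigma> t > 0"
    and deriv: "\<And>t. t > t1 \<Longrightarrow> (\<sigma> has_real_derivative \<sigma>' t) (at t)"
    and growth: "\<And>t. t > t1 \<Longrightarrow> b * \<sigma> t powr (3/2) \<le> \<sigma>' t"
  shows False
proof -
  have decay: "\<sigma> t powr (- 1/2) + b/2 * t \<le> \<sigma> t1 powr (- 1/2) + b/2 * t1" if "t \<ge> t1" for t
  proof (rule DERIV_nonpos_imp_decreasing_open[of t1 t "\<lambda>s. \<sigma> s powr (- 1/2) + b/2 * s"])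
    fix s assume s: "t1 < s" "s < t"
    then have "\<sigma> s > 0" using pos by simp
    have "((\<lambda>s. \<sigma> s powr (- 1/2)) has_real_derivative
        (- 1/2) * \<sigma> s powr (- 1/2 - 1) * \<sigma>' s) (at s)"
      by (rule DERIV_chain2[where f = "\<lambda>u. u powr (- 1/2)" and g = \<sigma>])
        (intro has_real_derivative_powr \<open>\<sigma> s > 0\<close> deriv s)+
    then have "((\<lambda>s. \<sigma> s powr (- 1/2) + b/2 * s) has_real_derivative
        (- 1/2) * \<sigma> s powr (- 3/2) * \<sigma>' s + b/2) (at s)"
      using DERIV_add[OF _ DERIV_cmult_Id[of "b/2"]] by fastforce
    moreover have "\<sigma> s powr (- 3/2) * (b * \<sigma> s powr (3/2)) \<le> \<sigma> s powr (- 3/2) * \<sigma>' s"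
      using growth[OF s(1)] by (intro mult_left_mono) auto
    then have "b \<le> \<sigma> s powr (- 3/2) * \<sigma>' s"
      using \<open>\<sigma> s > 0\<close> by (simp add: powr_minus field_simps)
    then have "(- 1/2) * \<sigma> s powr (- 3/2) * \<sigma>' s + b/2 \<le> 0" by simp
    ultimately show "\<exists>d. ((\<lambda>s. \<sigma> s powr (- 1/2) + b/2 * s) has_real_derivative d) (at s) \<and> d \<le> 0"
      by blast
  next
    have "continuous_on {t1..t} \<sigma>" using cont by (auto elim: continuous_on_subset)
    then show "continuous_on {t1..t} (\<lambda>s. \<sigma> s powr (- 1/2) + b/2 * s)"
      using pos by (intro continuous_intros) force+
  qed (rule that)
  define t where "t = t1 + 2/b * \<sigma> t1 powr (- 1/2)"
  have "t \<ge> t1" using b by (simp add: t_def)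
  have "b/2 * t = b/2 * t1 + \<sigma> t1 powr (- 1/2)" using b by (simp add: t_def field_simps)
  then have "\<sigma> t powr (- 1/2) \<le> 0" using decay[OF \<open>t \<ge> t1\<close>] by linarith
  then show False using pos[OF \<open>t \<ge> t1\<close>] by simp
qed

section \<open>The escape region\<close>

lemma power_add_ge:
  fixes a c :: real
  assumes "0 \<le> a" "0 \<le> c" "p \<ge> 1"
  shows "a ^ p + a ^ (p - 1) * c \<le> (a + c) ^ p"
proof -
  have split: "v ^ p = v ^ (p - 1) * v" for v :: real
    using assms(3) by (simp flip: power_Suc2)
  have "a ^ p + a ^ (p - 1) * c = a ^ (p - 1) * (a + c)"
    by (simp add: split[of a] algebra_simps)
  also have "\<dots> \<le> (a + c) ^ (p - 1) * (a + c)"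
    using assms by (intro mult_right_mono power_mono) auto
  finally show ?thesis by (simp add: split[of "a + c"])
qed

locale forced_oscillator =
  fixes g :: "real \<Rightarrow> real" and p :: nat and \<gamma> f F :: real
  assumes p: "p \<ge> 1" and \<gamma>: "\<gamma> > 0" and f: "0 < f" "f < F"
    and g_ge: "\<And>t. f ^ (2 * p) \<le> g t" and g_le: "\<And>t. g t \<le> F ^ (2 * p)"
begin

abbreviation \<xi> where "\<xi> \<equiv> xi p \<gamma> f F"

lemma xi_gt: "F < \<xi>" and h_xi: "h p \<gamma> f F (- \<xi>) = 0"
  using theI'[OF h_unique_root[OF p \<gamma> f]] by (simp_all add: xi_def)

lemma h_nonneg:
  assumes "x \<le> - \<xi>"
  shows "0 \<le> h p \<gamma> f F x"
proof (cases "x = - \<xi>")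
  case False
  then have "h p \<gamma> f F (- \<xi>) < h p \<gamma> f F x"
    using assms xi_gt p f by (intro h_strict_antimono) auto
  then show ?thesis by (simp add: h_xi)
qed (simp add: h_xi)

lemma power_ge_of_le:
  fixes x a :: real
  assumes "x \<le> - a" "0 \<le> a"
  shows "a ^ (2 * p) \<le> x ^ (2 * p)"
  using power_mono[of a "- x" "2 * p"] assms by simp

text \<open>The field must not point above the curve \<open>y = U b X0 x\<close>. With \<open>s = - X0 - x\<close>, on this curve
  \<open>y = - b s\<^sup>3\<^sup>/\<^sup>2\<close>, the forcing is at most \<open>F\<^sup>2\<^sup>p\<close>, the damping contributes \<open>\<gamma> b s\<^sup>3\<^sup>/\<^sup>2\<close>, and the
  motion of the curve along the orbit contributes \<open>3/2 b\<^sup>2 s\<^sup>2\<close>; together they must not exceed the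
  restoring term \<open>x\<^sup>2\<^sup>p\<close>.\<close>

definition curve_condition :: "real \<Rightarrow> real \<Rightarrow> bool" where
  "curve_condition b X0 \<longleftrightarrow> (\<forall>s\<ge>0. F ^ (2 * p) + \<gamma> * (b * s powr (3/2)) + 3/2 * b\<^sup>2 * s\<^sup>2
    \<le> (X0 + s) ^ (2 * p))"

text \<open>The excess \<open>(X0 + s)\<^sup>2\<^sup>p - F\<^sup>2\<^sup>p\<close> is at least \<open>\<delta> + k s\<^sup>2\<close> with positive \<open>\<delta>\<close> and \<open>k\<close> that do not
  depend on \<open>X0\<close>. The terms on the left are of order \<open>b (1 + s\<^sup>2)\<close> because the exponent \<open>3/2\<close> lies
  below \<open>2\<close>; hence one bound on \<open>b\<close> serves all \<open>X0\<close>.\<close>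

lemma curve_condition_of_small:
  "\<exists>b0>0. \<forall>b. 0 < b \<and> b \<le> b0 \<longrightarrow> (\<forall>X0\<ge>\<xi>. curve_condition b X0)"
proof -
  define \<delta> where "\<delta> = \<xi> ^ (2 * p) - F ^ (2 * p)"
  define k where "k = (\<xi>\<^sup>2) ^ (p - 1)"
  define b0 where "b0 = min 1 (min (\<delta> / \<gamma>) (k / (\<gamma> + 3/2)))"
  have "\<delta> > 0" using xi_gt f p by (auto simp: \<delta>_def intro!: power_strict_mono)
  moreover have "k > 0" using xi_gt f by (simp add: k_def)
  ultimately have "b0 > 0" using \<gamma> by (simp add: b0_def)
  moreover have "curve_condition b X0" if b: "0 < b" "b \<le> b0" and X0: "X0 \<ge> \<xi>" for b X0
    unfolding curve_condition_def
  proof (intro allI impI)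
    fix s :: real assume "s \<ge> 0"
    have "b \<le> \<delta> / \<gamma>" "b \<le> 1" "b \<le> k / (\<gamma> + 3/2)"
      using b by (auto simp: b0_def)
    then have le: "\<gamma> * b \<le> \<delta>" "b * (\<gamma> + 3/2) \<le> k"
      using \<gamma> by (auto simp: field_simps)
    have "b\<^sup>2 \<le> b" using b \<open>b \<le> 1\<close> by (simp add: power2_eq_square mult_left_le)
    have powr: "s powr (3/2) \<le> 1 + s\<^sup>2"
    proof (cases "s \<le> 1")
      case True
      then have "s powr (3/2) \<le> 1" using \<open>s \<ge> 0\<close> by (intro powr_le1) auto
      then show ?thesis by (simp add: add_increasing2)
    next
      case False
      then have "s powr (3/2) \<le> s powr 2" by (intro powr_mono) auto
      then show ?thesis using False by simp
    qed
    have "F ^ (2 * p) + \<gamma> * (b * s powr (3/2)) + 3/2 * b\<^sup>2 * s\<^sup>2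
        \<le> F ^ (2 * p) + \<gamma> * (b * (1 + s\<^sup>2)) + 3/2 * b * s\<^sup>2"
      using powr b \<gamma> \<open>b\<^sup>2 \<le> b\<close> by (intro add_mono mult_left_mono mult_right_mono) auto
    also have "\<dots> = F ^ (2 * p) + \<gamma> * b + b * (\<gamma> + 3/2) * s\<^sup>2"
      by (simp add: algebra_simps)
    also have "\<dots> \<le> F ^ (2 * p) + \<delta> + k * s\<^sup>2"
      using le by (intro add_mono mult_right_mono) auto
    also have "\<dots> = (\<xi>\<^sup>2) ^ p + (\<xi>\<^sup>2) ^ (p - 1) * s\<^sup>2"
      by (simp add: \<delta>_def k_def power_mult)
    also have "\<dots> \<le> (\<xi>\<^sup>2 + s\<^sup>2) ^ p"
      using p by (intro power_add_ge) auto
    also have "\<dots> \<le> ((X0 + s)\<^sup>2) ^ p"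
    proof (rule power_mono)
      have "\<xi>\<^sup>2 + s\<^sup>2 \<le> (\<xi> + s)\<^sup>2" using xi_gt f \<open>s \<ge> 0\<close> by (simp add: power2_sum)
      also have "\<dots> \<le> (X0 + s)\<^sup>2" using xi_gt f \<open>s \<ge> 0\<close> X0 by (intro power_mono) auto
      finally show "\<xi>\<^sup>2 + s\<^sup>2 \<le> (X0 + s)\<^sup>2" .
    qed auto
    also have "\<dots> = (X0 + s) ^ (2 * p)" by (simp add: power_mult)
    finally show "F ^ (2 * p) + \<gamma> * (b * s powr (3/2)) + 3/2 * b\<^sup>2 * s\<^sup>2 \<le> (X0 + s) ^ (2 * p)" .
  qed
  ultimately show ?thesis by blast
qed

text \<open>The right-hand side is the derivative of \<open>U b X0 x - y\<close> along an orbit. Above the curve it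
  dominates its value on the curve, because both the damping and the slope of \<open>U\<close> multiply \<open>y\<close> by
  a nonnegative factor. The bound \<open>x \<le> - F\<close> covers a neighbourhood of the line \<open>x = - \<xi>\<close>,
  which leaves room for a bootstrap argument on \<open>x\<close>.\<close>

lemma upper_curve_drift:
  assumes b: "b > 0" and cc: "curve_condition b X0"
    and x: "x \<le> - F" and y: "U b X0 x < y"
  shows "0 \<le> 3/2 * b * sqrt (max 0 (- X0 - x)) * y - (g t - \<gamma> * y - x ^ (2 * p))"
proof (cases "x \<le> - X0")
  case True
  define s where "s = - X0 - x"
  have s: "s \<ge> 0" "x = - (X0 + s)" using True by (auto simp: s_def)
  then have y': "- b * s powr (3/2) \<le> y" using y by (simp add: U_def)
  have s2: "sqrt s * s powr (3/2) = s\<^sup>2"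
    using s(1) by (cases "s = 0") (auto simp: powr_half_sqrt[symmetric] simp flip: powr_add)
  have "3/2 * b * sqrt s * (- b * s powr (3/2)) \<le> 3/2 * b * sqrt s * y"
    using y' b s by (intro mult_left_mono) auto
  moreover have "3/2 * b * sqrt s * (- b * s powr (3/2)) = - (3/2 * b\<^sup>2 * s\<^sup>2)"
    using s2 by (simp add: power2_eq_square)
  moreover have "\<gamma> * (- b * s powr (3/2)) \<le> \<gamma> * y"
    using y' \<gamma> by (intro mult_left_mono) auto
  moreover have "F ^ (2 * p) + \<gamma> * (b * s powr (3/2)) + 3/2 * b\<^sup>2 * s\<^sup>2 \<le> (X0 + s) ^ (2 * p)"
    using cc s by (simp add: curve_condition_def)
  moreover have "x ^ (2 * p) = (X0 + s) ^ (2 * p)" unfolding s(2) by (rule power_minus_even) simp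
  moreover have max_s: "max 0 (- X0 - x) = s" using s(1) by (simp add: s_def)
  ultimately show ?thesis using g_le[of t] unfolding max_s by linarith
next
  case False
  then have "0 < \<gamma> * y" using y \<gamma> by (simp add: U_def)
  moreover have "F ^ (2 * p) \<le> x ^ (2 * p)" using x f by (intro power_ge_of_le) auto
  moreover have "max 0 (- X0 - x) = 0" using False by simp
  ultimately show ?thesis using g_le[of t] by simp
qed

text \<open>The right-hand side is the derivative of \<open>y - (F\<^sup>2\<^sup>p - x\<^sup>2\<^sup>p) / \<gamma>\<close> along an orbit. On the lower curve
  it equals \<open>g t - f\<^sup>2\<^sup>p + h x / \<gamma>\<^sup>2\<close>, which is where \<open>h\<close> and its root come from; below the curve it is
  larger still.\<close>

lemma lower_curve_drift:
  assumes x: "x \<le> - \<xi>" and y: "y < (F ^ (2 * p) - x ^ (2 * p)) / \<gamma>"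
  shows "0 \<le> g t - \<gamma> * y - x ^ (2 * p) + 2 * real p * x ^ (2 * p - 1) * y / \<gamma>"
proof -
  define L where "L = (F ^ (2 * p) - x ^ (2 * p)) / \<gamma>"
  have L: "\<gamma> * L = F ^ (2 * p) - x ^ (2 * p)" using \<gamma> by (simp add: L_def)
  have "x < 0" using x xi_gt f by simp
  then have pow_neg: "x ^ (2 * p - 1) < 0" using p by (simp add: power_less_zero_eq)
  have neg: "2 * real p * x ^ (2 * p - 1) / \<gamma> \<le> 0"
    using \<gamma> by (intro divide_nonpos_pos mult_nonneg_nonpos less_imp_le[OF pow_neg]) auto
  have "\<gamma> * y \<le> \<gamma> * L" using y \<gamma> unfolding L_def by (intro mult_left_mono) auto
  moreover have "2 * real p * x ^ (2 * p - 1) / \<gamma> * L \<le> 2 * real p * x ^ (2 * p - 1) / \<gamma> * y"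
    using y neg by (intro mult_left_mono_neg) (auto simp: L_def)
  moreover have "2 * real p * x ^ (2 * p - 1) / \<gamma> * L = h p \<gamma> f F x / \<gamma>\<^sup>2 + (F ^ (2 * p) - f ^ (2 * p))"
    using \<gamma> by (simp add: h_def L_def field_simps power2_eq_square)
  moreover have "0 \<le> h p \<gamma> f F x / \<gamma>\<^sup>2" using h_nonneg[OF x] by simp
  ultimately show ?thesis using L g_ge[of t] by simp
qed

text \<open>The three sides of the region depend on each other: the upper curve is a barrier while
  \<open>x \<le> - F\<close>, and \<open>x\<close> cannot increase while the orbit is below that curve. Since
  \<open>- \<xi> < - F\<close>, a bootstrap closes this circle without any case analysis at the corners.\<close>

lemma S_positively_invariant:
  assumes b: "b > 0" and cc: "curve_condition b X0"
  shows "positively_invariant (vector_field g \<gamma> p) (S p \<gamma> f F b X0)"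
  unfolding positively_invariant_def
proof (intro allI impI, elim conjE, rule ballI)
  fix t0 t1 :: real and z t
  assume sol: "solves (vector_field g \<gamma> p) {t0..t1} z" and init: "z t0 \<in> S p \<gamma> f F b X0"
    and t: "t \<in> {t0..t1}"
  define x where "x s = fst (z s)" for s
  define y where "y s = snd (z s)" for s
  have z: "z s = (x s, y s)" for s by (simp add: x_def y_def)
  have D: "(z has_vector_derivative vector_field g \<gamma> p s (z s)) (at s within {t0..t1})"
    if "s \<in> {t0..t1}" for s using sol that by (simp add: solves_def)
  have "continuous_on {t0..t1} z" using D by (rule continuous_on_vector_derivative)
  then have cont: "continuous_on {t0..t1} x" "continuous_on {t0..t1} y"
    unfolding x_def[abs_def] y_def[abs_def] by (auto intro!: continuous_intros)
  have dx: "(x has_real_derivative y s) (at s)"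
    and dy: "(y has_real_derivative g s - \<gamma> * y s - x s ^ (2 * p)) (at s)"
    if "t0 < s" "s < t1" for s
    using vector_field_components[OF D, of s] that
    by (simp_all add: x_def[abs_def] y_def[abs_def] at_within_Icc_at)
  have init': "x t0 \<le> - \<xi>" "y t0 \<le> U b X0 (x t0)" "(F ^ (2 * p) - x t0 ^ (2 * p)) / \<gamma> \<le> y t0"
    using init by (auto simp: S_def z)
  have U_cont: "continuous_on A (U b X0)" for A
    using U_has_real_derivative by (meson DERIV_continuous continuous_at_imp_continuous_on)
  have upper: "y r \<le> U b X0 (x r)"
    if r: "r \<in> {t0..t1}" and left: "\<And>s. s \<in> {t0..r} \<Longrightarrow> x s \<le> - F" for r
  proof -
    have "0 \<le> U b X0 (x r) - y r"
    proof (rule barrier_nonneg[where a = t0 and b = r and t = r])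
      show "continuous_on {t0..r} (\<lambda>s. U b X0 (x s) - y s)"
        using cont r
        by (intro continuous_intros continuous_on_compose2[OF U_cont[of UNIV]])
          (auto elim: continuous_on_subset)
      show "((\<lambda>s. U b X0 (x s) - y s) has_real_derivative
          3/2 * b * sqrt (max 0 (- X0 - x s)) * y s - (g s - \<gamma> * y s - x s ^ (2 * p))) (at s)"
        if "t0 < s" "s < r" for s
        using that r
        by (intro derivative_intros DERIV_chain2[OF U_has_real_derivative] dx dy) auto
      show "0 \<le> 3/2 * b * sqrt (max 0 (- X0 - x s)) * y s - (g s - \<gamma> * y s - x s ^ (2 * p))"
        if "t0 < s" "s < r" "U b X0 (x s) - y s < 0" for s
        using that left[of s] by (intro upper_curve_drift b cc) auto
    qed (use r init' in auto)
    then show ?thesis by simp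
  qed
  have x_le: "x r \<le> - \<xi>" if "r \<in> {t0..t1}" for r
  proof (rule bootstrap_upper_bound[OF cont(1) init'(1) _ _ that])
    show "- \<xi> < - F" using xi_gt by simp
    fix r assume r: "r \<in> {t0..t1}" and left: "\<And>s. s \<in> {t0..r} \<Longrightarrow> x s \<le> - F"
    have "x t0 \<ge> x r"
    proof (rule DERIV_nonpos_imp_decreasing_open[of t0 r x])
      fix s assume s: "t0 < s" "s < r"
      have "y s \<le> U b X0 (x s)" using s r left by (intro upper) auto
      then have "y s \<le> 0" using U_nonpos[of b X0 "x s"] b by simp
      then show "\<exists>d. (x has_real_derivative d) (at s) \<and> d \<le> 0"
        using dx[of s] s r by auto
    qed (use r cont in \<open>auto elim: continuous_on_subset\<close>)
    then show "x r \<le> - \<xi>" using init'(1) by simp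
  qed
  have "0 \<le> y t - (F ^ (2 * p) - x t ^ (2 * p)) / \<gamma>"
  proof (rule barrier_nonneg[where a = t0 and b = t1 and t = t])
    show "continuous_on {t0..t1} (\<lambda>s. y s - (F ^ (2 * p) - x s ^ (2 * p)) / \<gamma>)"
      using cont \<gamma> by (intro continuous_intros) auto
    show "((\<lambda>s. y s - (F ^ (2 * p) - x s ^ (2 * p)) / \<gamma>) has_real_derivative
        g s - \<gamma> * y s - x s ^ (2 * p) + 2 * real p * x s ^ (2 * p - 1) * y s / \<gamma>) (at s)"
      if "t0 < s" "s < t1" for s
      using dx[OF that] dy[OF that] \<gamma> by (auto intro!: derivative_eq_intros)
    show "0 \<le> g s - \<gamma> * y s - x s ^ (2 * p) + 2 * real p * x s ^ (2 * p - 1) * y s / \<gamma>"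
      if "t0 < s" "s < t1" "y s - (F ^ (2 * p) - x s ^ (2 * p)) / \<gamma> < 0" for s
      using that x_le[of s] by (intro lower_curve_drift) auto
  qed (use t init' in auto)
  moreover have "y t \<le> U b X0 (x t)"
  proof (rule upper[OF t])
    show "x s \<le> - F" if "s \<in> {t0..t}" for s
      using x_le[of s] xi_gt t that by simp
  qed
  ultimately show "z t \<in> S p \<gamma> f F b X0"
    using x_le[OF t] by (simp add: S_def z)
qed

lemma S_subset_J: "b \<ge> 0 \<Longrightarrow> S p \<gamma> f F b X0 \<subseteq> J p \<gamma> f F"
  using U_nonpos by (fastforce simp: S_def J_def intro: order_trans)

lemma S_unbounded_below:
  assumes b: "b > 0" and X0: "X0 \<ge> \<xi>" and cc: "curve_condition b X0"
  shows "\<exists>x y. (x, y) \<in> S p \<gamma> f F b X0 \<and> y < M"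
proof -
  \<comment> \<open>The point of the upper curve at abscissa \<open>- X0 - s\<close>: since \<open>s \<ge> 1\<close>, its ordinate is at
    most \<open>- b s\<close>.\<close>
  define s where "s = 1 + \<bar>M\<bar> / b"
  have "s \<ge> 1" using b by (simp add: s_def)
  then have "s \<le> s powr (3/2)" using powr_mono[of 1 "3/2" s] by simp
  then have "b * s \<le> b * s powr (3/2)" using b by simp
  moreover have "b * s = b + \<bar>M\<bar>" using b by (simp add: s_def field_simps)
  ultimately have below: "- b * s powr (3/2) < M" using b by (simp add: abs_if split: if_splits)
  have even: "(- X0 - s) ^ (2 * p) = (X0 + s) ^ (2 * p)"
    using power_minus_even[of "2 * p" "X0 + s"] by simp
  have nonneg: "0 \<le> 3/2 * b\<^sup>2 * s\<^sup>2" by simp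
  have "F ^ (2 * p) + \<gamma> * (b * s powr (3/2)) + 3/2 * b\<^sup>2 * s\<^sup>2 \<le> (X0 + s) ^ (2 * p)"
    using cc \<open>s \<ge> 1\<close> by (simp add: curve_condition_def)
  then have "F ^ (2 * p) + \<gamma> * (b * s powr (3/2)) \<le> (- X0 - s) ^ (2 * p)"
    using even nonneg by linarith
  then have "(F ^ (2 * p) - (- X0 - s) ^ (2 * p)) / \<gamma> \<le> - b * s powr (3/2)"
    using \<gamma> by (simp add: field_simps)
  then show ?thesis
    using below \<open>s \<ge> 1\<close> X0
    by (intro exI[of _ "- X0 - s"] exI[of _ "- b * s powr (3/2)"]) (auto simp: S_def U_def)
qed

lemma admissible_of_small: "\<exists>b0>0. \<forall>b. 0 < b \<and> b \<le> b0 \<longrightarrow> admissible g p \<gamma> f F b"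
proof -
  obtain b0 where "b0 > 0" and cc: "\<And>b X0. 0 < b \<Longrightarrow> b \<le> b0 \<Longrightarrow> X0 \<ge> \<xi> \<Longrightarrow> curve_condition b X0"
    using curve_condition_of_small by blast
  have "admissible g p \<gamma> f F b" if b: "0 < b" "b \<le> b0" for b
    unfolding admissible_def
    using b cc[OF b] S_positively_invariant S_subset_J[of b] S_unbounded_below by simp
  then show ?thesis using \<open>b0 > 0\<close> by blast
qed

text \<open>The combination \<open>\<gamma> x + y\<close> has derivative \<open>g t - x\<^sup>2\<^sup>p\<close>, in which the damping cancels, so it
  decreases at a uniform rate. While \<open>x \<ge> - X0\<close> the lower curve bounds \<open>y\<close>, and hence the combination,
  from below; therefore \<open>x\<close> passes \<open>- X0\<close>. From then on the upper curve gives
  \<open>\<sigma>' \<ge> b \<sigma>\<^sup>3\<^sup>/\<^sup>2\<close> for the distance \<open>\<sigma> = - X0 - x\<close> travelled beyond it.\<close>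

lemma no_global_solution_in_S:
  assumes b: "b > 0"
    and sol: "solves (vector_field g \<gamma> p) {0..} z"
    and conf: "\<And>t. t \<ge> 0 \<Longrightarrow> z t \<in> S p \<gamma> f F b X0"
  shows False
proof -
  define x where "x s = fst (z s)" for s
  define y where "y s = snd (z s)" for s
  have z: "z s = (x s, y s)" for s by (simp add: x_def y_def)
  have D: "(z has_vector_derivative vector_field g \<gamma> p s (z s)) (at s within {0..})"
    if "s \<in> {0..}" for s using sol that by (simp add: solves_def)
  have "continuous_on {0..} z" using D by (rule continuous_on_vector_derivative)
  then have cont: "continuous_on {0..} x" "continuous_on {0..} y"
    unfolding x_def[abs_def] y_def[abs_def] by (auto intro!: continuous_intros)
  have dx: "(x has_real_derivative y s) (at s)"
    and dy: "(y has_real_derivative g s - \<gamma> * y s - x s ^ (2 * p)) (at s)" if "s > 0" for s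
    using vector_field_components[OF D, of s] that
    by (simp_all add: x_def[abs_def] y_def[abs_def] at_within_interior[of s "{0..}"])
  have x_le: "x s \<le> - \<xi>" and y_le: "y s \<le> U b X0 (x s)"
    and y_ge: "(F ^ (2 * p) - x s ^ (2 * p)) / \<gamma> \<le> y s" if "s \<ge> 0" for s
    using conf[OF that] by (auto simp: S_def z)
  have y_nonpos: "y s \<le> 0" if "s \<ge> 0" for s
    using y_le[OF that] U_nonpos[of b X0 "x s"] b by simp
  have x_antimono: "x t \<le> x s" if "0 \<le> s" "s \<le> t" for s t
  proof (rule DERIV_nonpos_imp_decreasing_open[of s t x])
    show "\<exists>d. (x has_real_derivative d) (at u) \<and> d \<le> 0" if "s < u" "u < t" for u
      using dx[of u] y_nonpos[of u] that \<open>0 \<le> s\<close> by auto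
  qed (use that cont in \<open>auto elim: continuous_on_subset\<close>)
  define \<delta> where "\<delta> = \<xi> ^ (2 * p) - F ^ (2 * p)"
  have "\<delta> > 0" using xi_gt f p by (auto simp: \<delta>_def intro!: power_strict_mono)
  have combination: "\<gamma> * x t + y t + \<delta> * t \<le> \<gamma> * x 0 + y 0" if "t \<ge> 0" for t
  proof -
    have "\<gamma> * x t + y t + \<delta> * t \<le> \<gamma> * x 0 + y 0 + \<delta> * 0"
    proof (rule DERIV_nonpos_imp_decreasing_open[of 0 t "\<lambda>s. \<gamma> * x s + y s + \<delta> * s"])
      fix s assume s: "0 < s" "s < t"
      have "((\<lambda>s. \<gamma> * x s + y s + \<delta> * s) has_real_derivative
          \<gamma> * y s + (g s - \<gamma> * y s - x s ^ (2 * p)) + \<delta>) (at s)"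
        using dx[of s] dy[of s] s by (auto intro!: derivative_eq_intros)
      moreover have "\<xi> ^ (2 * p) \<le> x s ^ (2 * p)"
        using x_le[of s] xi_gt f s by (intro power_ge_of_le) auto
      then have "\<gamma> * y s + (g s - \<gamma> * y s - x s ^ (2 * p)) + \<delta> \<le> 0"
        using g_le[of s] by (simp add: \<delta>_def)
      ultimately show "\<exists>d. ((\<lambda>s. \<gamma> * x s + y s + \<delta> * s) has_real_derivative d) (at s) \<and> d \<le> 0"
        by blast
    next
      show "continuous_on {0..t} (\<lambda>s. \<gamma> * x s + y s + \<delta> * s)"
        using cont by (intro continuous_intros) (auto elim: continuous_on_subset)
    qed (rule that)
    then show ?thesis by simp
  qed
  obtain t1 where "t1 \<ge> 0" and t1: "x t1 < - X0"
  proof -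
    \<comment> \<open>As long as \<open>x t \<ge> - X0\<close>, one has \<open>\<delta> * t \<le> C\<close>.\<close>
    define C where "C = \<gamma> * X0 + (X0 ^ (2 * p) - F ^ (2 * p)) / \<gamma> + \<gamma> * x 0 + y 0"
    define t where "t = (\<bar>C\<bar> + 1) / \<delta>"
    have t: "t \<ge> 0" "\<delta> * t = \<bar>C\<bar> + 1" using \<open>\<delta> > 0\<close> by (auto simp: t_def)
    have "x t < - X0"
    proof (rule ccontr)
      assume ge: "\<not> x t < - X0"
      then have "\<gamma> * (- X0) \<le> \<gamma> * x t" using \<gamma> by (intro mult_left_mono) auto
      moreover have "(- x t) ^ (2 * p) \<le> X0 ^ (2 * p)"
        using ge x_le[OF t(1)] xi_gt f by (intro power_mono) auto
      then have "(F ^ (2 * p) - X0 ^ (2 * p)) / \<gamma> \<le> (F ^ (2 * p) - x t ^ (2 * p)) / \<gamma>"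
        using \<gamma> by (intro divide_right_mono) auto
      then have "- ((X0 ^ (2 * p) - F ^ (2 * p)) / \<gamma>) \<le> y t"
        using y_ge[OF t(1)] by (simp add: diff_divide_distrib)
      ultimately have "\<delta> * t \<le> C"
        using combination[OF t(1)] by (simp add: C_def)
      then show False using t(2) by simp
    qed
    then show thesis using that t(1) by blast
  qed
  define \<sigma> where "\<sigma> t = - X0 - x t" for t
  have \<sigma>_pos: "\<sigma> t > 0" if "t \<ge> t1" for t
    using x_antimono[OF \<open>t1 \<ge> 0\<close> that] t1 by (simp add: \<sigma>_def)
  show False
  proof (rule no_global_growth_three_halves[OF b, of t1 \<sigma> "\<lambda>s. - y s"])
    have "continuous_on {t1..} x"
      using cont(1) \<open>t1 \<ge> 0\<close> by (auto elim: continuous_on_subset)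
    then show "continuous_on {t1..} \<sigma>"
      unfolding \<sigma>_def[abs_def] by (intro continuous_intros)
    show "(\<sigma> has_real_derivative - y s) (at s)" if "s > t1" for s
      unfolding \<sigma>_def[abs_def] using dx[of s] that \<open>t1 \<ge> 0\<close> by (auto intro!: derivative_eq_intros)
    show "b * \<sigma> s powr (3/2) \<le> - y s" if "s > t1" for s
      using y_le[of s] that \<open>t1 \<ge> 0\<close> \<sigma>_pos[of s] by (simp add: U_def \<sigma>_def)
  qed (rule \<sigma>_pos)
qed

text \<open>The upper curve may leave the axis at the abscissa of the point itself, where its ordinate is
  still \<open>0\<close>.\<close>

lemma J_point_in_S:
  assumes "z0 \<in> J p \<gamma> f F"
  shows "\<exists>X0. - X0 \<le> - \<xi> \<and> z0 \<in> S p \<gamma> f F b X0"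
  using assms by (intro exI[of _ "- fst z0"]) (auto simp: J_def S_def U_def)

lemma solution_in_S_blows_up:
  assumes g: "continuous_on UNIV g" and adm: "admissible g p \<gamma> f F b"
    and X0: "- X0 \<le> - \<xi>" and init: "z 0 \<in> S p \<gamma> f F b X0"
    and max: "maximal_solution (vector_field g \<gamma> p) T z"
  shows "blows_up_in_finite_time T z"
proof -
  have "T > 0" and sol: "solves (vector_field g \<gamma> p) (forward_interval T) z"
    using max by (auto simp: maximal_solution_def)
  have inv: "positively_invariant (vector_field g \<gamma> p) (S p \<gamma> f F b X0)" and "b > 0"
    using adm X0 by (auto simp: admissible_def)
  have stay: "z t \<in> S p \<gamma> f F b X0" if "t \<in> forward_interval T" for t
  proof -
    have sub: "{0..t} \<subseteq> forward_interval T"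
      using that by (auto simp: forward_interval_def intro: le_less_trans[of _ "ereal t"])
    then have "solves (vector_field g \<gamma> p) {0..t} z"
      using sol unfolding solves_def by (blast intro: has_vector_derivative_within_subset)
    then show ?thesis
      using inv init that unfolding positively_invariant_def
      by (auto simp: forward_interval_def)
  qed
  have "T \<noteq> \<infinity>"
  proof
    assume "T = \<infinity>"
    then have "forward_interval T = {0..}" by (auto simp: forward_interval_def)
    then show False
      using no_global_solution_in_S[of b z X0] \<open>b > 0\<close> sol stay by auto
  qed
  then obtain r where "T = ereal r" using \<open>T > 0\<close> by (cases T) auto
  then show ?thesis
    using maximal_solution_unbounded[OF g] max by (auto simp: blows_up_in_finite_time_def)
qed

end

theorem theorem6:
  fixes \<Phi> :: "real ^ 'd \<Rightarrow> real" and \<omega> :: "real ^ 'd"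
    and p :: nat and \<gamma> f F :: real and g :: "real \<Rightarrow> real"
  assumes "real_analytic \<Phi>" and "torus_periodic \<Phi>"
    and "g = (\<lambda>t. \<Phi> (t *\<^sub>R \<omega>))"
    and "p \<ge> 1" and "\<gamma> > 0" and "0 < f" and "f < F"
    and "\<And>t. f ^ (2 * p) \<le> g t" and "\<And>t. g t \<le> F ^ (2 * p)"
  shows "(\<exists>!r. r < - F \<and> h p \<gamma> f F r = 0) \<and>
    (\<exists>b0>0. \<forall>b. 0 < b \<and> b \<le> b0 \<longrightarrow> admissible g p \<gamma> f F b) \<and>
    (\<forall>b. admissible g p \<gamma> f F b \<longrightarrow>
      (\<forall>z0 \<in> J p \<gamma> f F. \<exists>X0. - X0 \<le> - xi p \<gamma> f F \<and> z0 \<in> S p \<gamma> f F b X0) \<and>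
      (\<forall>z0 X0. - X0 \<le> - xi p \<gamma> f F \<and> z0 \<in> S p \<gamma> f F b X0 \<longrightarrow>
        (\<forall>T z. maximal_solution (vector_field g \<gamma> p) T z \<and> z 0 = z0 \<longrightarrow>
          blows_up_in_finite_time T z)))"
proof -
  interpret forced_oscillator g p \<gamma> f F
    using assms(4-9) by unfold_locales auto
  have "continuous_on UNIV g"
    unfolding assms(3)
    by (intro continuous_on_compose2[OF real_analytic_imp_continuous[OF assms(1)]]
        continuous_intros) auto
  then show ?thesis
    using h_unique_root[OF assms(4-7)] admissible_of_small J_point_in_S solution_in_S_blows_up
    by blast
qed

end
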